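(* For every positive integer $d$, almost all $d$-regular graphs have separation dimension at least $\lceil d/2\rceil$; that is, if $G_n$ is chosen uniformly at random among all labelled $d$-regular graphs on $n$ vertices, then $\Pr[\pi(G_n)\geq \lceil d/2\rceil]\to 1$ as $n\to\infty$ (over $n$ for which such graphs exist).
   Context: For a permutation (total order) $\sigma$ of a finite set $U$ and disjoint subsets $A,B\subseteq U$, write $A \prec_\sigma B$ if every element of $A$ precedes every element of $B$ in $\sigma$; $\sigma$ separates $A$ and $B$ if $A\prec_\sigma B$ or $B\prec_\sigma A$. A family $\mathcal{F}$ of permutations of $V(G)$ is pairwise suitable for a graph $G$ if for every two disjoint edges $e,f$ of $G$ (viewed as 2-element vertex sets) some $\sigma\in\mathcal{F}$ separates $e$ and $f$. The separation dimension $\pi(G)$ is the minimum cardinality of a family of permutations pairwise suitable for $G$. *)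

theory Defs
  imports Complex_Main
begin

definition is_perm_of :: "'a set \<Rightarrow> 'a list \<Rightarrow> bool" where
  "is_perm_of U \<sigma> \<longleftrightarrow> distinct \<sigma> \<and> set \<sigma> = U"

definition precedes_set :: "'a list \<Rightarrow> 'a set \<Rightarrow> 'a set \<Rightarrow> bool" where
  "precedes_set \<sigma> A B \<longleftrightarrow>
     (\<forall>a\<in>A. \<forall>b\<in>B. \<exists>i j. i < j \<and> j < length \<sigma> \<and> \<sigma> ! i = a \<and> \<sigma> ! j = b)"

definition separates :: "'a list \<Rightarrow> 'a set \<Rightarrow> 'a set \<Rightarrow> bool" where
  "separates \<sigma> A B \<longleftrightarrow> precedes_set \<sigma> A B \<or> precedes_set \<sigma> B A"

text \<open>Graphs: vertex set V and edge set E, edges being 2-element subsets of V.\<close>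
definition pairwise_suitable :: "'a set \<Rightarrow> 'a set set \<Rightarrow> 'a list set \<Rightarrow> bool" where
  "pairwise_suitable V E F \<longleftrightarrow>
     (\<forall>\<sigma>\<in>F. is_perm_of V \<sigma>) \<and>
     (\<forall>e\<in>E. \<forall>f\<in>E. e \<inter> f = {} \<longrightarrow> (\<exists>\<sigma>\<in>F. separates \<sigma> e f))"

definition sep_dim :: "'a set \<Rightarrow> 'a set set \<Rightarrow> nat" where
  "sep_dim V E = (LEAST k. \<exists>F. finite F \<and> card F = k \<and> pairwise_suitable V E F)"

definition regular_graphs :: "nat \<Rightarrow> nat \<Rightarrow> nat set set set" where
  "regular_graphs n d = {E. (\<forall>e\<in>E. e \<subseteq> {0..<n} \<and> card e = 2) \<and>
                            (\<forall>v<n. card {e\<in>E. v \<in> e} = d)}"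

definition prob_sep_ge :: "nat \<Rightarrow> nat \<Rightarrow> nat \<Rightarrow> real" where
  "prob_sep_ge n d k =
     real (card {E \<in> regular_graphs n d. sep_dim {0..<n} E \<ge> k}) / real (card (regular_graphs n d))"

end

theory Submission
  imports Defs "HOL-Library.FuncSet" "HOL-Combinatorics.Multiset_Permutations" "HOL-Real_Asymp.Real_Asymp"
begin

text \<open>
  At most \<^term>\<open>(fact n + 1) ^ k\<close> families of at most \<open>k\<close> permutations exist, while there
  are at least \<open>n\<close> to the power \<open>d n / 2 - o(n)\<close> regular graphs as soon as there is one. So it
  suffices that a fixed family is pairwise suitable for only \<open>n\<close> to the power \<open>o(n)\<close> graphs of
  maximum degree \<open>d\<close>.

  For that, cut every permutation dyadically. In each permutation the ends of an edge are
  separated at a definite dyadic level, so an edge determines a level vector and a dyadic box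
  containing it. Two edges with the same level vector and box straddle the same midpoint
  in every permutation, hence are not separated and must intersect; therefore at most \<open>2 d\<close> edges share
  level vector and box. Large boxes are few and contribute few edges, whereas an edge in a small
  box leaves only polylogarithmically many choices for its second end.

  The lower bound on the number of regular graphs on \<open>n\<close> vertices takes the least \<open>n\<^sub>0\<close> congruent to
  \<open>n\<close> modulo \<open>2 d\<close> for which there is one, splits the other \<open>n - n\<^sub>0\<close> vertices into \<open>2 d\<close> equal blocks,
  and joins each of \<open>d\<close> left blocks to each of \<open>d\<close> right blocks by an arbitrary perfect matching.
\<close>

subsection \<open>Graphs suitable for a fixed family\<close>

text \<open>Induction on \<open>d\<close>: a set with at most \<open>Suc d\<close> elements is a set
  with at most \<open>d\<close> elements, either kept or enlarged by one element of
  \<open>S\<close>. The option type makes these \<open>card S + 1\<close> choices. The bound serves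
  for neighbourhoods, for sets of exceptional edges and for families of permutations alike.\<close>

lemma card_bounded_subsets:
  assumes "finite S"
  shows "card {T. T \<subseteq> S \<and> card T \<le> d} \<le> (card S + 1) ^ d"
proof (induction d)
  case 0
  have "{T. T \<subseteq> S \<and> card T \<le> 0} \<subseteq> {{}}"
    using assms by (auto simp: finite_subset dest: finite_subset)
  then have "card {T. T \<subseteq> S \<and> card T \<le> 0} \<le> card {{} :: 'a set}"
    by (intro card_mono) auto
  then show ?case by simp
next
  case (Suc d)
  let ?X = "insert None (Some ` S)"
  let ?P = "\<lambda>d. {T. T \<subseteq> S \<and> card T \<le> d}"
  let ?h = "\<lambda>(c, T). case c of None \<Rightarrow> T | Some x \<Rightarrow> insert x T"
  have fin: "finite (?X \<times> ?P d)" using assms by auto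
  have "?P (Suc d) \<subseteq> ?h ` (?X \<times> ?P d)"
  proof
    fix T assume T: "T \<in> ?P (Suc d)"
    show "T \<in> ?h ` (?X \<times> ?P d)"
    proof (cases "card T \<le> d")
      case True
      then show ?thesis using T by (auto intro!: image_eqI[of _ _ "(None, T)"])
    next
      case False
      then obtain x where x: "x \<in> T" by fastforce
      have "finite T" using T assms finite_subset by auto
      then have "card (T - {x}) \<le> d" using T card_Suc_Diff1[OF _ x] by simp
      moreover have "T - {x} \<subseteq> S" "x \<in> S" using T x by auto
      ultimately show ?thesis using x
        by (intro image_eqI[of _ _ "(Some x, T - {x})"]) auto
    qed
  qed
  then have "card (?P (Suc d)) \<le> card (?h ` (?X \<times> ?P d))"
    using fin by (intro card_mono) auto
  also have "\<dots> \<le> card (?X \<times> ?P d)" using fin by (rule card_image_le)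
  also have "\<dots> = (card S + 1) * card (?P d)"
    using assms by (simp add: card_cartesian_product card_image)
  also have "\<dots> \<le> (card S + 1) * (card S + 1) ^ d" using Suc.IH by (intro mult_left_mono) auto
  finally show ?case by simp
qed

section \<open>Dyadic levels, midpoints and boxes\<close>

lemma dyadic_split_level:
  fixes x y L :: nat
  assumes "x < 2 ^ L" "y < 2 ^ L" "x \<noteq> y"
  obtains l where "l \<in> {1..L}" "x div 2 ^ l = y div 2 ^ l"
    "x div 2 ^ (l - 1) \<noteq> y div 2 ^ (l - 1)"
proof -
  \<comment> \<open>The first level at which both numbers fall into the same dyadic interval. Level
    \<open>L\<close> qualifies since both quotients are 0 there, and level 0 does not since
    \<open>x \<noteq> y\<close>; so \<open>l - 1\<close> is a genuine predecessor.\<close>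
  define l where "l = (LEAST l. x div 2 ^ l = y div 2 ^ l)"
  have L: "x div 2 ^ L = y div 2 ^ L" using assms by simp
  have l: "x div 2 ^ l = y div 2 ^ l" unfolding l_def by (rule LeastI[where P = "\<lambda>l. x div 2 ^ l = y div 2 ^ l", OF L])
  have "l \<le> L" unfolding l_def by (rule Least_le[where P = "\<lambda>l. x div 2 ^ l = y div 2 ^ l", OF L])
  have "l \<noteq> 0" using l assms(3) by (metis div_by_1 power_0)
  moreover have "x div 2 ^ (l - 1) \<noteq> y div 2 ^ (l - 1)"
    using not_less_Least[of "l - 1" "\<lambda>l. x div 2 ^ l = y div 2 ^ l"] \<open>l \<noteq> 0\<close>
    unfolding l_def[symmetric] by auto
  ultimately show ?thesis using that[of l] l \<open>l \<le> L\<close> by auto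
qed

text \<open>The dyadic interval of length \<open>2 ^ l\<close> with index \<open>q\<close> has the
  halves \<open>2 * q\<close> and \<open>2 * q + 1\<close> one level below, and the bound in the
  conclusion is its midpoint. Two numbers in the interval but in different halves lie on either side
  of it.\<close>

lemma dyadic_midpoint_straddled:
  fixes x y l :: nat
  assumes "1 \<le> l" "x div 2 ^ l = q" "y div 2 ^ l = q" "x div 2 ^ (l - 1) \<noteq> y div 2 ^ (l - 1)"
  shows "min x y < (2 * q + 1) * 2 ^ (l - 1)" "(2 * q + 1) * 2 ^ (l - 1) \<le> max x y"
proof -
  obtain j where l: "l = Suc j" using assms(1) by (cases l) auto
  have *: "z div 2 ^ l = z div 2 ^ j div 2" for z :: nat
    unfolding l power_Suc2 by (rule div_mult2_eq)
  have xy: "x div 2 ^ j div 2 = q" "y div 2 ^ j div 2 = q" "x div 2 ^ j \<noteq> y div 2 ^ j"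
    using assms unfolding * by (simp_all add: l)
  then have "x div 2 ^ j < 2 * q + 1 \<and> y div 2 ^ j \<ge> 2 * q + 1 \<or>
             y div 2 ^ j < 2 * q + 1 \<and> x div 2 ^ j \<ge> 2 * q + 1"
    by linarith
  then have "min x y < (2 * q + 1) * 2 ^ j \<and> (2 * q + 1) * 2 ^ j \<le> max x y"
    by (auto simp: div_less_iff_less_mult less_eq_div_iff_mult_less_eq min_def max_def)
  then show "min x y < (2 * q + 1) * 2 ^ (l - 1)" "(2 * q + 1) * 2 ^ (l - 1) \<le> max x y"
    by (simp_all add: l)
qed

text \<open>Vertices are points with one coordinate \<open>pos \<sigma>\<close> for each
  \<open>\<sigma>\<close> in \<open>F\<close>. For fixed \<open>l\<close> the boxes are the classes
  of an equivalence relation, hence pairwise disjoint.\<close>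

definition box_of :: "'a set \<Rightarrow> 'i set \<Rightarrow> ('i \<Rightarrow> 'a \<Rightarrow> nat) \<Rightarrow> ('i \<Rightarrow> nat) \<Rightarrow> 'a \<Rightarrow> 'a set" where
  "box_of V F pos l u = {w \<in> V. \<forall>\<sigma>\<in>F. pos \<sigma> w div 2 ^ l \<sigma> = pos \<sigma> u div 2 ^ l \<sigma>}"

text \<open>Since intervals that merge stay merged at higher levels, this determines each
  \<open>l \<sigma>\<close>: it is the first level at which the two coordinates agree.\<close>

definition splits_at :: "'i set \<Rightarrow> ('i \<Rightarrow> 'a \<Rightarrow> nat) \<Rightarrow> ('i \<Rightarrow> nat) \<Rightarrow> 'a \<Rightarrow> 'a \<Rightarrow> bool" where
  "splits_at F pos l u v \<longleftrightarrow> (\<forall>\<sigma>\<in>F. pos \<sigma> u div 2 ^ l \<sigma> = pos \<sigma> v div 2 ^ l \<sigma> \<and>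
     pos \<sigma> u div 2 ^ (l \<sigma> - 1) \<noteq> pos \<sigma> v div 2 ^ (l \<sigma> - 1))"

lemma splits_at_exists:
  assumes "u \<in> V" "v \<in> V" "u \<noteq> v"
    and "\<And>\<sigma>. \<sigma> \<in> F \<Longrightarrow> inj_on (pos \<sigma>) V" "\<And>\<sigma> w. \<sigma> \<in> F \<Longrightarrow> w \<in> V \<Longrightarrow> pos \<sigma> w < 2 ^ L"
  obtains l where "l \<in> F \<rightarrow>\<^sub>E {1..L}" "splits_at F pos l u v"
proof -
  have "\<forall>\<sigma>\<in>F. \<exists>l. l \<in> {1..L} \<and> pos \<sigma> u div 2 ^ l = pos \<sigma> v div 2 ^ l \<and>
     pos \<sigma> u div 2 ^ (l - 1) \<noteq> pos \<sigma> v div 2 ^ (l - 1)"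
  proof
    fix \<sigma> assume "\<sigma> \<in> F"
    then have "pos \<sigma> u < 2 ^ L" "pos \<sigma> v < 2 ^ L" "pos \<sigma> u \<noteq> pos \<sigma> v"
      using assms by (auto dest: inj_onD)
    then show "\<exists>l. l \<in> {1..L} \<and> pos \<sigma> u div 2 ^ l = pos \<sigma> v div 2 ^ l \<and>
     pos \<sigma> u div 2 ^ (l - 1) \<noteq> pos \<sigma> v div 2 ^ (l - 1)"
      by (meson dyadic_split_level)
  qed
  then obtain l where l: "\<forall>\<sigma>\<in>F. l \<sigma> \<in> {1..L} \<and> pos \<sigma> u div 2 ^ l \<sigma> = pos \<sigma> v div 2 ^ l \<sigma> \<and>
     pos \<sigma> u div 2 ^ (l \<sigma> - 1) \<noteq> pos \<sigma> v div 2 ^ (l \<sigma> - 1)" by metis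
  show ?thesis
    by (rule that[of "restrict l F"]) (use l in \<open>auto simp: splits_at_def\<close>)
qed

definition pos_separates :: "('a \<Rightarrow> nat) \<Rightarrow> 'a set \<Rightarrow> 'a set \<Rightarrow> bool" where
  "pos_separates p e f \<longleftrightarrow> (\<forall>a\<in>e. \<forall>b\<in>f. p a < p b) \<or> (\<forall>a\<in>e. \<forall>b\<in>f. p b < p a)"

text \<open>In coordinate \<open>\<sigma>\<close> both edges lie in one dyadic interval and straddle
  its midpoint \<open>c\<close>. Thus each edge has an end below \<open>c\<close> and an end at or
  above \<open>c\<close>, so neither edge can lie entirely before the other.\<close>

lemma same_box_not_separated:
  assumes "l \<in> F \<rightarrow>\<^sub>E {1..L}" "splits_at F pos l u v" "splits_at F pos l u' v'"
    "box_of V F pos l u = B" "box_of V F pos l u' = B" "u \<in> V" "\<sigma> \<in> F"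
  shows "\<not> pos_separates (pos \<sigma>) {u, v} {u', v'}"
proof -
  define q where "q = pos \<sigma> u div 2 ^ l \<sigma>"
  define c where "c = (2 * q + 1) * 2 ^ (l \<sigma> - 1)"
  have l1: "1 \<le> l \<sigma>" using assms(1,7) by auto
  \<comment> \<open>A vertex belongs to its own box, so equality of the boxes transfers the interval
    index \<open>q\<close> from \<open>u\<close> to \<open>u'\<close>.\<close>
  have "u \<in> box_of V F pos l u'" using assms(4,5,6) unfolding box_of_def by blast
  then have q': "pos \<sigma> u' div 2 ^ l \<sigma> = q" using assms(7) by (auto simp: box_of_def q_def)
  have v: "pos \<sigma> v div 2 ^ l \<sigma> = q" "pos \<sigma> u div 2 ^ (l \<sigma> - 1) \<noteq> pos \<sigma> v div 2 ^ (l \<sigma> - 1)"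
    using assms(2,7) by (auto simp: splits_at_def q_def)
  have v': "pos \<sigma> v' div 2 ^ l \<sigma> = q" "pos \<sigma> u' div 2 ^ (l \<sigma> - 1) \<noteq> pos \<sigma> v' div 2 ^ (l \<sigma> - 1)"
    using assms(3,7) q' by (auto simp: splits_at_def)
  have 1: "min (pos \<sigma> u) (pos \<sigma> v) < c" "c \<le> max (pos \<sigma> u) (pos \<sigma> v)"
    using dyadic_midpoint_straddled[OF l1 q_def[symmetric] v] by (auto simp: c_def)
  have 2: "min (pos \<sigma> u') (pos \<sigma> v') < c" "c \<le> max (pos \<sigma> u') (pos \<sigma> v')"
    using dyadic_midpoint_straddled[OF l1 q' v'] by (auto simp: c_def)
  show ?thesis
    using 1 2 by (auto simp: pos_separates_def min_def max_def split: if_splits)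
qed

section \<open>Edges in large boxes and candidates in small ones\<close>

lemma card_intersecting_edges:
  assumes "\<And>e. e \<in> C \<Longrightarrow> e \<in> E \<and> card e = 2" "\<And>e f. e \<in> C \<Longrightarrow> f \<in> C \<Longrightarrow> e \<inter> f \<noteq> {}"
    "\<And>e. e \<in> E \<Longrightarrow> e \<subseteq> V"
    and "\<And>v. v \<in> V \<Longrightarrow> card {e \<in> E. v \<in> e} \<le> d" "finite E"
  shows "card C \<le> 2 * d"
proof (cases "C = {}")
  case False
  then obtain e where e: "e \<in> C" by auto
  then obtain a b where ab: "e = {a, b}" "a \<in> V" "b \<in> V"
    using assms(1)[OF e] assms(3)[of e] by (auto simp: card_2_iff)
  \<comment> \<open>Every member of \<open>C\<close> meets the fixed member \<open>e\<close>, hence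
    contains \<open>a\<close> or \<open>b\<close>; each of these vertices has degree at most
    \<open>d\<close>.\<close>
  have "C \<subseteq> {e \<in> E. a \<in> e} \<union> {e \<in> E. b \<in> e}"
    using assms(1) assms(2)[OF e] ab(1) by auto
  then have "card C \<le> card ({e \<in> E. a \<in> e} \<union> {e \<in> E. b \<in> e})"
    using assms(5) by (intro card_mono) auto
  also have "\<dots> \<le> card {e \<in> E. a \<in> e} + card {e \<in> E. b \<in> e}" by (rule card_Un_le)
  also have "\<dots> \<le> d + d" using assms(4) ab by (intro add_mono) auto
  finally show ?thesis by simp
qed simp

lemma card_large_boxes:
  assumes "finite V" "m > 0"
  shows "card {B \<in> box_of V F pos l ` V. card B > m} \<le> card V div m"
proof -
  let ?X = "{B \<in> box_of V F pos l ` V. card B > m}"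
  have X: "finite ?X" using assms by auto
  have "m * card ?X \<le> (\<Sum>B\<in>?X. card B)"
    using sum_mono[of ?X "\<lambda>_. m" card] by (auto simp: mult.commute)
  also have "\<dots> = card (\<Union>?X)"
  proof (rule card_Union_disjoint[symmetric])
    show "pairwise disjnt ?X"
      by (auto simp: pairwise_def disjnt_def box_of_def)
    show "finite B" if "B \<in> ?X" for B
      using that assms by (auto simp: box_of_def)
  qed
  also have "\<dots> \<le> card V" using assms by (intro card_mono) (auto simp: box_of_def)
  finally show ?thesis using assms(2)
    by (simp add: less_eq_div_iff_mult_less_eq mult.commute)
qed

text \<open>The level vector ranges over all possibilities instead of being the one that splits an
  edge. Hence the candidate set of \<open>u\<close> depends on the family and on \<open>u\<close>
  alone, not on the graph, and can be fixed before graphs are counted.\<close>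

definition near :: "'a set \<Rightarrow> 'i set \<Rightarrow> ('i \<Rightarrow> 'a \<Rightarrow> nat) \<Rightarrow> nat \<Rightarrow> nat \<Rightarrow> 'a \<Rightarrow> 'a set" where
  "near V F pos L m u = {v \<in> V. \<exists>l \<in> F \<rightarrow>\<^sub>E {1..L}. v \<in> box_of V F pos l u \<and> card (box_of V F pos l u) \<le> m}"

lemma card_near:
  assumes "finite V" "finite F" "card F \<le> k" "L \<ge> 1"
  shows "card (near V F pos L m u) \<le> L ^ k * m"
proof -
  let ?\<Lambda> = "F \<rightarrow>\<^sub>E {1..L}"
  let ?S = "\<lambda>l. if card (box_of V F pos l u) \<le> m then box_of V F pos l u else {}"
  have fin: "finite ?\<Lambda>" using assms by (intro finite_PiE) auto
  have "near V F pos L m u \<subseteq> (\<Union>l\<in>?\<Lambda>. ?S l)" by (auto simp: near_def)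
  then have "card (near V F pos L m u) \<le> card (\<Union>l\<in>?\<Lambda>. ?S l)"
    using fin assms(1) by (intro card_mono) (auto simp: box_of_def)
  also have "\<dots> \<le> (\<Sum>l\<in>?\<Lambda>. card (?S l))" by (rule card_UN_le[OF fin])
  also have "\<dots> \<le> card ?\<Lambda> * m" using sum_bounded_above[of ?\<Lambda> "\<lambda>l. card (?S l)" m] by auto
  also have "\<dots> = L ^ card F * m" using assms by (simp add: card_PiE)
  also have "\<dots> \<le> L ^ k * m" using assms by (simp add: power_increasing)
  finally show ?thesis .
qed

definition bounded_degree_graphs :: "'a set \<Rightarrow> nat \<Rightarrow> 'a set set set" where
  "bounded_degree_graphs V d =
     {E. (\<forall>e\<in>E. e \<subseteq> V \<and> card e = 2) \<and> (\<forall>v\<in>V. card {e \<in> E. v \<in> e} \<le> d)}"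

definition far_edges :: "'a set \<Rightarrow> 'i set \<Rightarrow> ('i \<Rightarrow> 'a \<Rightarrow> nat) \<Rightarrow> nat \<Rightarrow> nat \<Rightarrow> 'a set set \<Rightarrow> 'a set set" where
  "far_edges V F pos L m E = {e \<in> E. \<nexists>u v. e = {u, v} \<and> v \<in> near V F pos L m u}"

text \<open>Classify a far edge by its splitting level vector and its box. The box has more than
  \<open>m\<close> vertices, for otherwise one end would be near the other. There are at most
  \<open>L ^ k\<close> level vectors, at most \<open>card V div m\<close> large boxes for each, and
  at most \<open>2 * d\<close> edges in a class, because edges of one class are never separated and
  so pairwise intersect.\<close>

lemma card_far_edges:
  fixes pos :: "'i \<Rightarrow> 'a \<Rightarrow> nat"
  assumes "finite V" "finite F" "card F \<le> k" "L \<ge> 1" "m > 0"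
    and E: "E \<in> bounded_degree_graphs V d"
    and pos: "\<And>\<sigma>. \<sigma> \<in> F \<Longrightarrow> inj_on (pos \<sigma>) V" "\<And>\<sigma> w. \<sigma> \<in> F \<Longrightarrow> w \<in> V \<Longrightarrow> pos \<sigma> w < 2 ^ L"
    and sep: "\<And>e f. e \<in> E \<Longrightarrow> f \<in> E \<Longrightarrow> e \<inter> f = {} \<Longrightarrow> \<exists>\<sigma>\<in>F. pos_separates (pos \<sigma>) e f"
  shows "card (far_edges V F pos L m E) \<le> L ^ k * ((card V div m) * (2 * d))"
proof -
  let ?\<Lambda> = "F \<rightarrow>\<^sub>E {1..L}"
  let ?X = "\<lambda>l. {B \<in> box_of V F pos l ` V. card B > m}"
  let ?C = "\<lambda>l B. {e \<in> E. \<exists>u v. e = {u, v} \<and> splits_at F pos l u v \<and> box_of V F pos l u = B}"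
  have fin: "finite ?\<Lambda>" using assms by (intro finite_PiE) auto
  have EV: "e \<subseteq> V" "card e = 2" if "e \<in> E" for e
    using E that by (auto simp: bounded_degree_graphs_def)
  have "E \<subseteq> Pow V" using EV by auto
  then have finE: "finite E" using assms(1) by (meson finite_Pow_iff finite_subset)
  have C: "card (?C l B) \<le> 2 * d" if l: "l \<in> ?\<Lambda>" for l B
  proof (rule card_intersecting_edges[where E = E and V = V])
    show "e \<inter> f \<noteq> {}" if e: "e \<in> ?C l B" and f: "f \<in> ?C l B" for e f
    proof
      assume "e \<inter> f = {}"
      then obtain \<sigma> where \<sigma>: "\<sigma> \<in> F" "pos_separates (pos \<sigma>) e f"
        using sep[of e f] e f by auto
      obtain u v where uv: "e = {u, v}" "splits_at F pos l u v" "box_of V F pos l u = B"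
        using e by auto
      obtain u' v' where uv': "f = {u', v'}" "splits_at F pos l u' v'" "box_of V F pos l u' = B"
        using f by auto
      have "u \<in> V" using EV[of e] e uv by auto
      then show False
        using same_box_not_separated[OF l uv(2) uv'(2) uv(3) uv'(3) _ \<sigma>(1)] \<sigma>(2) uv(1) uv'(1)
        by simp
    qed
  qed (use EV E finE in \<open>auto simp: bounded_degree_graphs_def\<close>)
  have "far_edges V F pos L m E \<subseteq> (\<Union>l\<in>?\<Lambda>. \<Union>B\<in>?X l. ?C l B)"
  proof
    fix e assume e: "e \<in> far_edges V F pos L m E"
    then have eE: "e \<in> E" by (auto simp: far_edges_def)
    obtain u v where uv: "e = {u, v}" "u \<noteq> v" "u \<in> V" "v \<in> V"
      using EV[OF eE] by (auto simp: card_2_iff)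
    obtain l where l: "l \<in> ?\<Lambda>" "splits_at F pos l u v"
      by (rule splits_at_exists[where pos = pos and F = F and L = L, OF uv(3,4,2) pos])
    have "v \<in> box_of V F pos l u" using l(2) uv by (auto simp: box_of_def splits_at_def)
    moreover have "v \<notin> near V F pos L m u" using e uv by (auto simp: far_edges_def)
    ultimately have "card (box_of V F pos l u) > m"
      using l(1) uv(4) by (force simp: near_def)
    then show "e \<in> (\<Union>l\<in>?\<Lambda>. \<Union>B\<in>?X l. ?C l B)"
      using l uv eE by blast
  qed
  then have "card (far_edges V F pos L m E) \<le> card (\<Union>l\<in>?\<Lambda>. \<Union>B\<in>?X l. ?C l B)"
    by (rule card_mono[rotated]) (rule finite_subset[OF _ finE], blast)
  also have "\<dots> \<le> (\<Sum>l\<in>?\<Lambda>. card (\<Union>B\<in>?X l. ?C l B))" by (rule card_UN_le[OF fin])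
  also have "\<dots> \<le> (\<Sum>l\<in>?\<Lambda>. (card V div m) * (2 * d))"
  proof (rule sum_mono)
    fix l assume l: "l \<in> ?\<Lambda>"
    have "card (\<Union>B\<in>?X l. ?C l B) \<le> (\<Sum>B\<in>?X l. card (?C l B))"
      using assms(1) by (intro card_UN_le) auto
    also have "\<dots> \<le> (\<Sum>B\<in>?X l. 2 * d)" by (intro sum_mono C[OF l])
    also have "\<dots> = card (?X l) * (2 * d)" by simp
    also have "\<dots> \<le> (card V div m) * (2 * d)"
      using card_large_boxes[OF assms(1,5)] by (intro mult_right_mono) auto
    finally show "card (\<Union>B\<in>?X l. ?C l B) \<le> (card V div m) * (2 * d)" .
  qed
  also have "\<dots> = L ^ card F * ((card V div m) * (2 * d))"
    using assms by (simp add: card_PiE)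
  also have "\<dots> \<le> L ^ k * ((card V div m) * (2 * d))"
    using assms by (intro mult_right_mono) (auto simp: power_increasing)
  finally show ?thesis .
qed

text \<open>A graph is encoded by the set of near neighbours of each vertex together with its far
  edges. The first factor counts choices of at most \<open>d\<close> among \<open>L ^ k * m\<close>
  candidates at each vertex, the second counts sets of far edges.\<close>

lemma card_separated_graphs:
  fixes pos :: "'i \<Rightarrow> 'a \<Rightarrow> nat"
  assumes "finite V" "finite F" "card F \<le> k" "L \<ge> 1" "m > 0"
    and pos: "\<And>\<sigma>. \<sigma> \<in> F \<Longrightarrow> inj_on (pos \<sigma>) V" "\<And>\<sigma> w. \<sigma> \<in> F \<Longrightarrow> w \<in> V \<Longrightarrow> pos \<sigma> w < 2 ^ L"
  shows "card {E \<in> bounded_degree_graphs V d.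
            \<forall>e\<in>E. \<forall>f\<in>E. e \<inter> f = {} \<longrightarrow> (\<exists>\<sigma>\<in>F. pos_separates (pos \<sigma>) e f)}
         \<le> (L ^ k * m + 1) ^ (d * card V) * ((card V)\<^sup>2 + 1) ^ (L ^ k * ((card V div m) * (2 * d)))"
    (is "card ?G \<le> _ * (_ ^ ?q)")
proof -
  let ?S = "near V F pos L m"
  let ?N = "\<lambda>u. {T. T \<subseteq> ?S u \<and> card T \<le> d}"
  let ?P = "{e. e \<subseteq> V \<and> card e = 2}"
  let ?Q = "{Q. Q \<subseteq> ?P \<and> card Q \<le> ?q}"
  let ?enc = "\<lambda>E. (\<lambda>u\<in>V. {v \<in> ?S u. {u, v} \<in> E}, far_edges V F pos L m E)"
  let ?dec = "\<lambda>(g, Q). (\<lambda>(u, v). {u, v}) ` (SIGMA u:V. g u) \<union> Q"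
  have finS: "finite (?S u)" for u using assms(1) by (auto simp: near_def)
  have finP: "finite ?P" using assms(1) by auto
  have finR: "finite (PiE V ?N \<times> ?Q)"
    using assms(1) finS finP by (intro finite_cartesian_product finite_PiE) auto
  have EV: "e \<subseteq> V" "card e = 2" if "e \<in> E" "E \<in> ?G" for e E
    using that by (auto simp: bounded_degree_graphs_def)
  have inj: "inj_on ?enc ?G"
  \<comment> \<open>Decoding joins each vertex to its recorded near neighbours and adds the far
    edges. An edge that is not far is recorded at one of its ends at least.\<close>
  proof (rule inj_on_inverseI[where g = ?dec])
    fix E assume E: "E \<in> ?G"
    have "e \<in> ?dec (?enc E)" if e: "e \<in> E" for e
    proof (cases "e \<in> far_edges V F pos L m E")
      case False
      then obtain u v where uv: "e = {u, v}" "v \<in> ?S u" using e by (auto simp: far_edges_def)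
      then show ?thesis using e EV[OF e E] by (auto intro!: image_eqI[of _ _ "(u, v)"])
    qed auto
    moreover have "?dec (?enc E) \<subseteq> E" by (auto simp: far_edges_def)
    ultimately show "?dec (?enc E) = E" by blast
  qed
  have "?enc ` ?G \<subseteq> PiE V ?N \<times> ?Q"
  proof
    fix x assume "x \<in> ?enc ` ?G"
    then obtain E where E: "E \<in> ?G" and x: "x = ?enc E" by auto
    have "E \<subseteq> Pow V" using EV[OF _ E] by auto
    then have finE: "finite E" using assms(1) by (meson finite_Pow_iff finite_subset)
    have "card {v \<in> ?S u. {u, v} \<in> E} \<le> d" if "u \<in> V" for u
    proof -
      have "card {v \<in> ?S u. {u, v} \<in> E} \<le> card {e \<in> E. u \<in> e}"
        by (rule card_inj_on_le[where f = "\<lambda>v. {u, v}"])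
          (use finE in \<open>auto simp: inj_on_def doubleton_eq_iff\<close>)
      also have "\<dots> \<le> d" using E that by (auto simp: bounded_degree_graphs_def)
      finally show ?thesis .
    qed
    moreover have "card (far_edges V F pos L m E) \<le> ?q"
      using E by (intro card_far_edges[OF assms(1-5) _ pos]) auto
    moreover have "far_edges V F pos L m E \<subseteq> ?P"
      using EV[OF _ E] by (auto simp: far_edges_def)
    ultimately show "x \<in> PiE V ?N \<times> ?Q" unfolding x by auto
  qed
  then have "card ?G \<le> card (PiE V ?N \<times> ?Q)"
    using card_inj_on_le[OF inj _ finR] by simp
  also have "\<dots> = (\<Prod>u\<in>V. card (?N u)) * card ?Q"
    using assms(1) by (simp add: card_cartesian_product card_PiE)
  also have "\<dots> \<le> (\<Prod>u\<in>V. (L ^ k * m + 1) ^ d) * ((card V)\<^sup>2 + 1) ^ ?q"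
  proof (intro mult_mono prod_mono conjI)
    show "card (?N u) \<le> (L ^ k * m + 1) ^ d" if "u \<in> V" for u
    proof -
      have "card (?N u) \<le> (card (?S u) + 1) ^ d" by (rule card_bounded_subsets[OF finS])
      also have "\<dots> \<le> (L ^ k * m + 1) ^ d"
        using card_near[OF assms(1-4), of pos m u] by (intro power_mono) auto
      finally show ?thesis .
    qed
    have "card ?P = card V choose 2" using n_subsets[OF assms(1), of 2] by simp
    also have "\<dots> \<le> card V ^ 2"
      using binomial_fact_pow[of "card V" 2] by (simp add: fact_2)
    finally have "card ?P \<le> (card V)\<^sup>2" .
    then show "card ?Q \<le> ((card V)\<^sup>2 + 1) ^ ?q"
      using card_bounded_subsets[OF finP, of ?q]
      by (meson add_le_mono1 le_trans power_mono zero_le)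
  qed auto
  also have "(\<Prod>u\<in>V. (L ^ k * m + 1) ^ d) = (L ^ k * m + 1) ^ (d * card V)"
    by (simp add: power_mult)
  finally show ?thesis by (simp add: mult.commute mult.left_commute)
qed

subsection \<open>Many regular graphs\<close>

lemma finite_regular_graphs: "finite (regular_graphs n d)"
proof (rule finite_subset)
  show "regular_graphs n d \<subseteq> Pow (Pow {0..<n})" by (auto simp: regular_graphs_def)
qed simp

section \<open>Block coordinates and grid graphs\<close>

lemma block_index_eq_iff:
  fixes b x b' x' s :: nat
  assumes "x < s" "x' < s"
  shows "b * s + x = b' * s + x' \<longleftrightarrow> b = b' \<and> x = x'"
proof
  assume *: "b * s + x = b' * s + x'"
  have "(b * s + x) div s = b" "(b' * s + x') div s = b'" using assms by auto
  then have "b = b'" using * by metis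
  then show "b = b' \<and> x = x'" using * by simp
qed simp

lemma block_index_less:
  fixes b x d s :: nat
  assumes "b < d" "x < s"
  shows "b * s + x < d * s"
proof -
  have "b * s + x < (b + 1) * s" using assms by simp
  also have "\<dots> \<le> d * s" using assms by (intro mult_right_mono) auto
  finally show ?thesis .
qed

lemma block_index_exists:
  fixes v d s :: nat
  assumes "v < d * s"
  obtains b x where "b < d" "x < s" "v = b * s + x"
proof
  show "v div s < d" using assms by (simp add: less_mult_imp_div_less)
  show "v mod s < s" using assms by (cases "s = 0") auto
qed simp

text \<open>After the first \<open>n\<close> vertices come \<open>d\<close> left blocks and then
  \<open>d\<close> right blocks, all of size \<open>s\<close>. The permutation
  \<open>p (b, c)\<close> is the perfect matching from left block \<open>b\<close> to right block
  \<open>c\<close>.\<close>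

definition grid_edge :: "nat \<Rightarrow> nat \<Rightarrow> nat \<Rightarrow> (nat \<times> nat \<Rightarrow> nat \<Rightarrow> nat) \<Rightarrow> nat \<Rightarrow> nat \<Rightarrow> nat \<Rightarrow> nat set" where
  "grid_edge n d s p b c x = {n + (b * s + x), n + d * s + (c * s + p (b, c) x)}"

definition grid_graph :: "nat \<Rightarrow> nat \<Rightarrow> nat \<Rightarrow> (nat \<times> nat \<Rightarrow> nat \<Rightarrow> nat) \<Rightarrow> nat set set" where
  "grid_graph n d s p = {grid_edge n d s p b c x |b c x. b < d \<and> c < d \<and> x < s}"

context
  fixes n d s :: nat
begin

abbreviation grid_perms :: "(nat \<times> nat \<Rightarrow> nat \<Rightarrow> nat) set" where
  "grid_perms \<equiv> {..<d} \<times> {..<d} \<rightarrow>\<^sub>E {q. q permutes {..<s}}"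

lemma grid_perms_less:
  assumes "p \<in> grid_perms" "b < d" "c < d" "x < s"
  shows "p (b, c) x < s"
proof -
  have "p (b, c) permutes {..<s}" using assms by auto
  then show ?thesis using assms(4) permutes_in_image by fastforce
qed

lemma left_vertex_in_grid_edge:
  assumes "b' < d" "x' < s" "b < d" "x < s"
  shows "n + (b' * s + x') \<in> grid_edge n d s p b c x \<longleftrightarrow> b = b' \<and> x = x'"
  using block_index_less[OF assms(1,2)] block_index_eq_iff[OF assms(2,4)] 
  by (auto simp: grid_edge_def)

lemma right_vertex_in_grid_edge:
  assumes "p \<in> grid_perms" "b < d" "x < s" "c < d" "y < s"
  shows "n + d * s + (c' * s + y) \<in> grid_edge n d s p b c x \<longleftrightarrow> c = c' \<and> p (b, c) x = y"
  using block_index_less[OF assms(2,3)] block_index_eq_iff[OF assms(5) grid_perms_less[OF assms(1,2,4,3)], of c' c]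
  by (auto simp: grid_edge_def)

lemma grid_edge_subset:
  assumes "p \<in> grid_perms" "b < d" "x < s" "c < d"
  shows "grid_edge n d s p b c x \<subseteq> {n..<n + 2 * d * s}"
  using block_index_less[OF assms(2,3)] block_index_less[OF assms(4) grid_perms_less[OF assms(1,2,4,3)]]
  by (auto simp: grid_edge_def)

lemma card_grid_edge:
  assumes "b < d" "x < s"
  shows "card (grid_edge n d s p b c x) = 2"
  using block_index_less[OF assms] by (auto simp: grid_edge_def card_2_iff)

lemma grid_graph_subset:
  assumes "p \<in> grid_perms" "e \<in> grid_graph n d s p"
  shows "e \<subseteq> {n..<n + 2 * d * s} \<and> card e = 2"
proof -
  obtain b c x where "b < d" "c < d" "x < s" "e = grid_edge n d s p b c x"
    using assms(2) by (auto simp: grid_graph_def)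
  then show ?thesis using grid_edge_subset[OF assms(1)] card_grid_edge by blast
qed

text \<open>A left vertex has exactly one neighbour in each right block. A right vertex has exactly
  one in each left block, found by inverting the matching permutation.\<close>

lemma grid_graph_regular:
  assumes p: "p \<in> grid_perms" and v: "n \<le> v" "v < n + 2 * d * s"
  shows "card {e \<in> grid_graph n d s p. v \<in> e} = d"
proof (cases "v < n + d * s")
  case True
  then have "v - n < d * s" using v by simp
  then obtain b x where "b < d" "x < s" "v - n = b * s + x" by (rule block_index_exists)
  then have bx: "b < d" "x < s" "v = n + (b * s + x)" using v by auto
  have "{e \<in> grid_graph n d s p. v \<in> e} = (\<lambda>c. grid_edge n d s p b c x) ` {..<d}"
    using bx left_vertex_in_grid_edge[OF bx(1,2)] by (fastforce simp: grid_graph_def)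
  moreover have "inj_on (\<lambda>c. grid_edge n d s p b c x) {..<d}"
  proof (rule inj_onI)
    fix c c' assume c: "c \<in> {..<d}" "c' \<in> {..<d}"
      and eq: "grid_edge n d s p b c x = grid_edge n d s p b c' x"
    \<comment> \<open>The right end of an edge reveals its right block, so different
      \<open>c\<close> give different edges.\<close>
    have "n + d * s + (c * s + p (b, c) x) \<in> grid_edge n d s p b c' x"
      unfolding eq[symmetric] by (simp add: grid_edge_def)
    then show "c = c'"
      using right_vertex_in_grid_edge[OF p bx(1,2), of c' "p (b, c) x" c] grid_perms_less[OF p bx(1) _ bx(2)] c
      by auto
  qed
  ultimately show ?thesis by (simp add: card_image)
next
  case False
  then have "v - (n + d * s) < d * s" using v by (simp add: mult_2 algebra_simps)
  then obtain c y where "c < d" "y < s" "v - (n + d * s) = c * s + y" by (rule block_index_exists)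
  then have cy: "c < d" "y < s" "v = n + d * s + (c * s + y)" using False by auto
  let ?x = "\<lambda>b. inv (p (b, c)) y"
  have perm: "p (b, c) permutes {..<s}" if "b < d" for b using p cy(1) that by auto
  have x: "?x b < s" if "b < d" for b
    using permutes_in_image[OF permutes_inv[OF perm[OF that]]] cy(2) by auto
  have px: "p (b, c) x = y \<longleftrightarrow> x = ?x b" if "b < d" for b x
    using permutes_inv_eq[OF perm[OF that]] by metis
  have "{e \<in> grid_graph n d s p. v \<in> e} = (\<lambda>b. grid_edge n d s p b c (?x b)) ` {..<d}"
  proof (intro equalityI subsetI)
    fix e assume "e \<in> {e \<in> grid_graph n d s p. v \<in> e}"
    then obtain b c' x where *: "b < d" "c' < d" "x < s" "e = grid_edge n d s p b c' x" "v \<in> e"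
      by (auto simp: grid_graph_def)
    then have "c' = c" "x = ?x b"
      using right_vertex_in_grid_edge[OF p *(1,3,2) cy(2), of c] px[OF *(1)] cy(3) by auto
    then show "e \<in> (\<lambda>b. grid_edge n d s p b c (?x b)) ` {..<d}" using * by auto
  next
    fix e assume "e \<in> (\<lambda>b. grid_edge n d s p b c (?x b)) ` {..<d}"
    then obtain b where b: "b < d" "e = grid_edge n d s p b c (?x b)" by auto
    then have "v \<in> e"
      using right_vertex_in_grid_edge[OF p b(1) x[OF b(1)] cy(1,2), of c] px[OF b(1)] cy(3) by auto
    then show "e \<in> {e \<in> grid_graph n d s p. v \<in> e}"
      using b x[OF b(1)] cy(1) by (auto simp: grid_graph_def)
  qed
  moreover have "inj_on (\<lambda>b. grid_edge n d s p b c (?x b)) {..<d}"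
  proof (rule inj_onI)
    fix b b' assume b: "b \<in> {..<d}" "b' \<in> {..<d}"
      and eq: "grid_edge n d s p b c (?x b) = grid_edge n d s p b' c (?x b')"
    have "n + (b * s + ?x b) \<in> grid_edge n d s p b' c (?x b')"
      unfolding eq[symmetric] by (simp add: grid_edge_def)
    then show "b = b'" using left_vertex_in_grid_edge[of b "?x b" b' "?x b'"] b x by auto
  qed
  ultimately show ?thesis by (simp add: card_image)
qed

text \<open>The only edge from offset \<open>x\<close> of left block \<open>b\<close> into right
  block \<open>c\<close> reveals \<open>p (b, c) x\<close>. Beyond \<open>s\<close> all the
  permutations are the identity.\<close>

lemma inj_on_grid_graph: "inj_on (grid_graph n d s) grid_perms"
proof (rule inj_onI)
  fix p p' assume p: "p \<in> grid_perms" "p' \<in> grid_perms" and eq: "grid_graph n d s p = grid_graph n d s p'"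
  show "p = p'"
  proof (rule PiE_ext[OF p])
    fix i assume "i \<in> {..<d} \<times> {..<d}"
    then obtain b c where i: "i = (b, c)" "b < d" "c < d" by auto
    have perm: "p (b, c) permutes {..<s}" "p' (b, c) permutes {..<s}" using p i by auto
    have "p (b, c) x = p' (b, c) x" for x
    proof (cases "x < s")
      case True
      have "grid_edge n d s p b c x \<in> grid_graph n d s p'"
        unfolding eq[symmetric] using i True by (auto simp: grid_graph_def)
      then obtain b' c' x' where *: "b' < d" "c' < d" "x' < s"
        "grid_edge n d s p b c x = grid_edge n d s p' b' c' x'" by (auto simp: grid_graph_def)
      have "n + (b * s + x) \<in> grid_edge n d s p' b' c' x'"
        "n + d * s + (c * s + p (b, c) x) \<in> grid_edge n d s p' b' c' x'"
        unfolding *(4)[symmetric] by (simp_all add: grid_edge_def)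
      then show ?thesis
        using left_vertex_in_grid_edge[OF i(2) True *(1,3)] grid_perms_less[OF p(1) i(2,3) True]
          right_vertex_in_grid_edge[OF p(2) *(1,3,2), of "p (b, c) x" c] by auto
    next
      case False
      then show ?thesis using perm by (auto simp: permutes_def)
    qed
    then show "p i = p' i" using i by auto
  qed
qed

text \<open>Keep one \<open>d\<close>-regular graph on the first \<open>n\<close> vertices and place
  an arbitrary grid graph beside it. The edge sets are disjoint, so the union determines the grid
  graph, and there are \<open>fact s ^ (d * d)\<close> of these.\<close>

lemma card_regular_graphs_ge:
  assumes "regular_graphs n d \<noteq> {}"
  shows "fact s ^ (d * d) \<le> card (regular_graphs (n + 2 * d * s) d)"
proof -
  obtain E where E: "E \<in> regular_graphs n d" using assms by auto
  have En: "e \<subseteq> {0..<n}" "card e = 2" if "e \<in> E" for e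
    using E that by (auto simp: regular_graphs_def)
  let ?\<Phi> = "\<lambda>p. E \<union> grid_graph n d s p"
  have disj: "E \<inter> grid_graph n d s p = {}" if "p \<in> grid_perms" for p
  proof (rule ccontr)
    assume "E \<inter> grid_graph n d s p \<noteq> {}"
    then obtain e where e: "e \<in> E" "e \<in> grid_graph n d s p" by auto
    then have "e \<subseteq> {0..<n} \<inter> {n..<n + 2 * d * s}"
      using En(1)[OF e(1)] grid_graph_subset[OF that e(2)] by (intro Int_greatest) auto
    then have "e = {}" by auto
    then show False using En(2)[OF e(1)] by auto
  qed
  have inj: "inj_on ?\<Phi> grid_perms"
  proof (rule inj_onI)
    fix p p' assume p: "p \<in> grid_perms" "p' \<in> grid_perms" and eq: "?\<Phi> p = ?\<Phi> p'"
    have "grid_graph n d s p = grid_graph n d s p'"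
      using eq disj[OF p(1)] disj[OF p(2)] by blast
    then show "p = p'" using inj_on_grid_graph p by (auto dest: inj_onD)
  qed
  have sub: "?\<Phi> ` grid_perms \<subseteq> regular_graphs (n + 2 * d * s) d"
  proof (rule image_subsetI)
    fix p assume p: "p \<in> grid_perms"
    have "e \<subseteq> {0..<n + 2 * d * s} \<and> card e = 2" if "e \<in> ?\<Phi> p" for e
    proof (cases "e \<in> E")
      case True
      then have "e \<subseteq> {0..<n}" "card e = 2" using En by auto
      then show ?thesis by auto
    next
      case False
      then have "e \<subseteq> {n..<n + 2 * d * s}" "card e = 2" using that grid_graph_subset[OF p] by auto
      then show ?thesis by auto
    qed
    moreover have "card {e \<in> ?\<Phi> p. v \<in> e} = d" if v: "v < n + 2 * d * s" for v
    proof (cases "v < n")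
      case True
      then have "v \<notin> e" if "e \<in> grid_graph n d s p" for e
        using grid_graph_subset[OF p that] by auto
      then have "{e \<in> ?\<Phi> p. v \<in> e} = {e \<in> E. v \<in> e}" by blast
      then show ?thesis using E True by (auto simp: regular_graphs_def)
    next
      case False
      then have "v \<notin> e" if "e \<in> E" for e using En(1)[OF that] by auto
      then have "{e \<in> ?\<Phi> p. v \<in> e} = {e \<in> grid_graph n d s p. v \<in> e}" by blast
      then show ?thesis using grid_graph_regular[OF p _ v] False by auto
    qed
    ultimately show "?\<Phi> p \<in> regular_graphs (n + 2 * d * s) d"
      unfolding regular_graphs_def by blast
  qed
  have "fact s ^ (d * d) = card grid_perms"
    using card_permutations[of "{..<s}" s] by (simp add: card_PiE)
  also have "\<dots> \<le> card (regular_graphs (n + 2 * d * s) d)"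
    by (rule card_inj_on_le[OF inj sub finite_regular_graphs])
  finally show ?thesis by simp
qed

end

subsection \<open>Comparison of the two counts\<close>

lemma separating_permutation_exists:
  assumes "finite V" "e \<subseteq> V" "f \<subseteq> V" "e \<inter> f = {}"
  obtains \<sigma> where "is_perm_of V \<sigma>" "separates \<sigma> e f"
proof -
  have "finite e" "finite f" "finite (V - e - f)" using assms by (auto intro: finite_subset)
  then obtain xs ys zs where xyz: "set xs = e" "distinct xs" "set ys = f" "distinct ys"
    "set zs = V - e - f" "distinct zs"
    by (meson finite_distinct_list)
  have "is_perm_of V (xs @ ys @ zs)" using xyz assms by (auto simp: is_perm_of_def)
  moreover have "precedes_set (xs @ ys @ zs) e f"
    unfolding precedes_set_def
  proof (intro ballI)
    fix a b assume "a \<in> e" "b \<in> f"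
    then obtain i j where "i < length xs" "xs ! i = a" "j < length ys" "ys ! j = b"
      using xyz by (metis in_set_conv_nth)
    then show "\<exists>i j. i < j \<and> j < length (xs @ ys @ zs) \<and> (xs @ ys @ zs) ! i = a \<and> (xs @ ys @ zs) ! j = b"
      by (intro exI[of _ i] exI[of _ "length xs + j"]) (auto simp: nth_append)
  qed
  ultimately show ?thesis using that by (auto simp: separates_def)
qed

text \<open>The \<open>LEAST\<close> in \<open>sep_dim\<close> carries information only if some
  suitable finite family exists; the family of all permutations is one.\<close>

lemma sep_dim_attained:
  assumes "finite V" "\<And>e. e \<in> E \<Longrightarrow> e \<subseteq> V"
  obtains F where "finite F" "card F = sep_dim V E" "pairwise_suitable V E F"
proof -
  have "pairwise_suitable V E (permutations_of_set V)"
    unfolding pairwise_suitable_def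
  proof (intro conjI ballI impI)
    show "is_perm_of V \<sigma>" if "\<sigma> \<in> permutations_of_set V" for \<sigma>
      using that by (auto simp: permutations_of_set_def is_perm_of_def)
    fix e f assume "e \<in> E" "f \<in> E" "e \<inter> f = {}"
    then obtain \<sigma> where "is_perm_of V \<sigma>" "separates \<sigma> e f"
      using separating_permutation_exists assms by metis
    then show "\<exists>\<sigma>\<in>permutations_of_set V. separates \<sigma> e f"
      by (auto simp: permutations_of_set_def is_perm_of_def)
  qed
  then have "\<exists>k F. finite F \<and> card F = k \<and> pairwise_suitable V E F"
    by (metis finite_permutations_of_set)
  from LeastI_ex[OF this] show ?thesis
    unfolding sep_dim_def[symmetric] using that by auto
qed

section \<open>Positions in a permutation, and the union bound over families\<close>

definition list_pos :: "'a list \<Rightarrow> 'a \<Rightarrow> nat" where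
  "list_pos \<sigma> = inv_into {..<length \<sigma>} ((!) \<sigma>)"

lemma list_pos_nth: "distinct \<sigma> \<Longrightarrow> i < length \<sigma> \<Longrightarrow> list_pos \<sigma> (\<sigma> ! i) = i"
  unfolding list_pos_def by (rule inv_into_f_f) (auto simp: inj_on_def nth_eq_iff_index_eq)

lemma set_conv_nth_image: "set \<sigma> = (!) \<sigma> ` {..<length \<sigma>}"
  by (auto simp: set_conv_nth)

lemma list_pos_less: "v \<in> set \<sigma> \<Longrightarrow> list_pos \<sigma> v < length \<sigma>"
  using inv_into_into[of v "(!) \<sigma>" "{..<length \<sigma>}"] by (simp add: list_pos_def set_conv_nth_image)

lemma inj_on_list_pos: "inj_on (list_pos \<sigma>) (set \<sigma>)"
  unfolding list_pos_def by (rule inj_on_inv_into) (simp add: set_conv_nth_image)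

lemma separates_imp_pos_separates:
  assumes "distinct \<sigma>" "separates \<sigma> e f"
  shows "pos_separates (list_pos \<sigma>) e f"
proof -
  have "list_pos \<sigma> a < list_pos \<sigma> b" if "precedes_set \<sigma> A B" "a \<in> A" "b \<in> B" for A B a b
    using that assms(1) list_pos_nth unfolding precedes_set_def by (metis less_trans)
  then show ?thesis using assms(2) unfolding separates_def pos_separates_def by blast
qed

text \<open>Union bound: a graph of separation dimension at most \<open>k\<close> is counted for
  some set of at most \<open>k\<close> permutations. There are at most
  \<open>(fact (card V) + 1) ^ k\<close> such sets, and \<open>card_separated_graphs\<close> bounds
  the graphs for each.\<close>

lemma card_sep_dim_le:
  assumes "finite V" "card V \<le> 2 ^ L" "L \<ge> 1" "m > 0"
  shows "card {E \<in> bounded_degree_graphs V d. sep_dim V E \<le> k} \<le>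
    (fact (card V) + 1) ^ k *
    ((L ^ k * m + 1) ^ (d * card V) * ((card V)\<^sup>2 + 1) ^ (L ^ k * ((card V div m) * (2 * d))))"
    (is "card ?A \<le> (_ + 1) ^ k * ?M")
proof -
  let ?P = "permutations_of_set V"
  let ?\<F> = "{F. F \<subseteq> ?P \<and> card F \<le> k}"
  let ?G = "\<lambda>F. {E \<in> bounded_degree_graphs V d.
            \<forall>e\<in>E. \<forall>f\<in>E. e \<inter> f = {} \<longrightarrow> (\<exists>\<sigma>\<in>F. pos_separates (list_pos \<sigma>) e f)}"
  have fin: "finite ?\<F>" using assms(1) by simp
  have "bounded_degree_graphs V d \<subseteq> Pow (Pow V)" by (auto simp: bounded_degree_graphs_def)
  then have finG: "finite (bounded_degree_graphs V d)" using assms(1) finite_subset by blast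
  have "?A \<subseteq> (\<Union>F\<in>?\<F>. ?G F)"
  proof
    fix E assume E: "E \<in> ?A"
    then have "e \<subseteq> V" if "e \<in> E" for e using that by (auto simp: bounded_degree_graphs_def)
    then obtain F where F: "finite F" "card F = sep_dim V E" "pairwise_suitable V E F"
      using sep_dim_attained[OF assms(1)] by metis
    have perm: "is_perm_of V \<sigma>" if "\<sigma> \<in> F" for \<sigma> using F that by (auto simp: pairwise_suitable_def)
    have "F \<in> ?\<F>" using perm F E by (auto simp: is_perm_of_def permutations_of_set_def)
    moreover have "\<exists>\<sigma>\<in>F. pos_separates (list_pos \<sigma>) e f"
      if ef: "e \<in> E" "f \<in> E" "e \<inter> f = {}" for e f
    proof -
      obtain \<sigma> where "\<sigma> \<in> F" "separates \<sigma> e f"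
        using F(3) ef unfolding pairwise_suitable_def by blast
      moreover from this have "pos_separates (list_pos \<sigma>) e f"
        using perm[of \<sigma>] separates_imp_pos_separates[of \<sigma> e f] by (simp add: is_perm_of_def)
      ultimately show ?thesis by blast
    qed
    ultimately show "E \<in> (\<Union>F\<in>?\<F>. ?G F)" using E by blast
  qed
  then have "card ?A \<le> card (\<Union>F\<in>?\<F>. ?G F)"
    using fin finG by (intro card_mono) auto
  also have "\<dots> \<le> (\<Sum>F\<in>?\<F>. card (?G F))" by (rule card_UN_le[OF fin])
  also have "\<dots> \<le> (\<Sum>F\<in>?\<F>. ?M)"
  proof (rule sum_mono)
    fix F assume F: "F \<in> ?\<F>"
    have perm: "set \<sigma> = V" "distinct \<sigma>" if "\<sigma> \<in> F" for \<sigma>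
    proof -
      have "\<sigma> \<in> ?P" using F that by blast
      then show "set \<sigma> = V" "distinct \<sigma>" by (simp_all add: permutations_of_set_def)
    qed
    show "card (?G F) \<le> ?M"
    proof (rule card_separated_graphs[OF assms(1) _ _ assms(3,4)])
      show "finite F" using F finite_subset[OF _ finite_permutations_of_set] by blast
      show "card F \<le> k" using F by auto
      show "inj_on (list_pos \<sigma>) V" if "\<sigma> \<in> F" for \<sigma> using inj_on_list_pos perm(1)[OF that] by metis
      show "list_pos \<sigma> w < 2 ^ L" if "\<sigma> \<in> F" "w \<in> V" for \<sigma> w
        using list_pos_less[of w \<sigma>] perm[OF that(1)] that(2) assms(2) distinct_card[of \<sigma>] by auto
    qed
  qed
  also have "\<dots> = card ?\<F> * ?M" by (simp only: sum_constant of_nat_id)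
  also have "\<dots> \<le> (card ?P + 1) ^ k * ?M"
    using assms(1) by (intro mult_right_mono card_bounded_subsets) auto
  finally show ?thesis using assms(1) by simp
qed

section \<open>Explicit exponential bounds for both counts\<close>

lemma fact_ge_exp:
  assumes "s > 0"
  shows "exp (real s * (ln (real s) - 1)) \<le> fact s"
proof -
  \<comment> \<open>The left side is a single term of the exponential series at
    \<open>s\<close>.\<close>
  have "real s ^ s / fact s \<le> exp (real s)"
    using sum_le_suminf[OF summable_exp[of "real s"], of "{s}"] exp_converges[of "real s"]
    by (simp add: exp_def field_simps)
  then have "real s ^ s / exp (real s) \<le> fact s" by (simp add: field_simps)
  moreover have "exp (real s * (ln (real s) - 1)) = real s ^ s / exp (real s)"
    using assms by (simp add: right_diff_distrib exp_diff exp_of_nat_mult)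
  ultimately show ?thesis by simp
qed

lemma card_regular_graphs_growth:
  assumes "d > 0"
  obtains C where "C \<ge> 0" "\<And>n. regular_graphs n d \<noteq> {} \<Longrightarrow> real n \<ge> C + 2 * d * exp 1 \<Longrightarrow>
    exp (d / 2 * (real n - C) * (ln ((real n - C) / (2 * d)) - 1)) \<le> card (regular_graphs n d)"
proof -
  define P where "P r n \<longleftrightarrow> n mod (2 * d) = r \<and> regular_graphs n d \<noteq> {}" for r n
  \<comment> \<open>Least order of a \<open>d\<close>-regular graph in residue class
    \<open>r\<close>. In a class without such graphs the value is unspecified, which only enlarges
    the sum \<open>C\<close>; that sum dominates every starting order at once.\<close>
  define N where "N r = (LEAST n. P r n)" for r
  define C where "C = (\<Sum>r<2 * d. N r)"
  have "exp (d / 2 * (real n - C) * (ln ((real n - C) / (2 * d)) - 1)) \<le> card (regular_graphs n d)"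
    if n: "regular_graphs n d \<noteq> {}" "real n \<ge> real C + 2 * d * exp 1" for n
  proof -
    define n0 where "n0 = N (n mod (2 * d))"
    have "P (n mod (2 * d)) n" using n by (simp add: P_def)
    then have P: "P (n mod (2 * d)) n0" "n0 \<le> n"
      unfolding n0_def N_def by (rule LeastI, rule Least_le)
    have "n0 \<le> C" unfolding n0_def C_def using assms by (intro member_le_sum) auto
    have "2 * d dvd n - n0" using P(1) mod_eq_dvd_iff_nat[OF P(2), of "2 * d"] by (simp add: P_def)
    then obtain s where "n - n0 = 2 * d * s" by blast
    then have s: "n = n0 + 2 * d * s" using P(2) by simp
    \<comment> \<open>A lower bound for the block size \<open>s\<close> that no longer depends on
      the residue class. Since \<open>t \<ge> exp 1\<close>, the factor \<open>ln t - 1\<close> is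
      nonnegative, so replacing \<open>t\<close> by \<open>s\<close> enlarges both factors of
      \<open>t * (ln t - 1)\<close>.\<close>
    define t where "t = (real n - C) / (2 * d)"
    have t: "t \<ge> exp 1" unfolding t_def using n(2) assms by (simp add: field_simps)
    have "t > 0" using t exp_gt_zero[of "1::real"] by linarith
    have "real n - C \<le> 2 * d * real s" using \<open>n0 \<le> C\<close> unfolding s by simp
    then have ts: "t \<le> s" unfolding t_def using assms by (simp add: field_simps)
    have ln: "1 \<le> ln t" "ln t \<le> ln s" using t ts \<open>t > 0\<close> by (auto simp: ln_ge_iff)
    have "d / 2 * (real n - C) * (ln ((real n - C) / (2 * d)) - 1) = (d * d) * (t * (ln t - 1))"
      using assms by (simp add: t_def field_simps)
    also have "\<dots> \<le> (d * d) * (real s * (ln s - 1))"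
      using ts ln \<open>t > 0\<close> by (intro mult_left_mono mult_mono) auto
    finally have "exp (d / 2 * (real n - C) * (ln ((real n - C) / (2 * d)) - 1)) \<le>
        exp ((d * d) * (real s * (ln s - 1)))" by simp
    also have "\<dots> = exp (real s * (ln s - 1)) ^ (d * d)"
      by (simp add: exp_of_nat_mult[symmetric])
    also have "\<dots> \<le> fact s ^ (d * d)"
      using ts \<open>t > 0\<close> by (intro power_mono fact_ge_exp) (auto intro: Nat.gr0I)
    also have "\<dots> \<le> real (card (regular_graphs n d))"
      using card_regular_graphs_ge[of n0 d s] P(1)
      unfolding s P_def by (metis of_nat_fact of_nat_le_iff of_nat_power)
    finally show ?thesis .
  qed
  then show ?thesis using that[of "real C"] by simp
qed

lemma card_small_sep_dim_regular_graphs: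
  assumes "n \<ge> 2"
  shows "real (card {E \<in> regular_graphs n d. sep_dim {0..<n} E \<le> k}) \<le>
    exp (real k * n * ln n + real d * n * (ln 2 + (2 * real k + 1) * ln (log 2 n + 1)) + 6 * real d * n)"
proof -
  define L where "L = nat \<lceil>log 2 n\<rceil>"
  have log1: "log 2 n \<ge> 1" using assms by simp
  then have L: "log 2 n \<le> L" "L \<le> log 2 n + 1" "L \<ge> 1" unfolding L_def by linarith+
  have "real n = 2 powr (log 2 n)" using assms by simp
  also have "\<dots> \<le> 2 powr L" using L by (intro powr_mono) auto
  also have "\<dots> = 2 ^ L" by (simp add: powr_realpow)
  finally have nL: "n \<le> 2 ^ L" by (metis of_nat_le_iff of_nat_numeral of_nat_power)
  \<comment> \<open>This threshold balances the two factors. One power of \<open>L\<close> beyond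
    \<open>L ^ k\<close> makes the number \<open>q\<close> of far edges at most
    \<open>2 * d * n / L\<close>, so they cost only a linear exponent, while
    \<open>L ^ k * m\<close> stays polylogarithmic in \<open>n\<close>.\<close>
  define m where "m = L ^ (k + 1)"
  have "m > 0" using L by (simp add: m_def)
  define q where "q = L ^ k * ((n div m) * (2 * d))"
  have "real q \<le> L ^ k * ((n / m) * (2 * d))"
    unfolding q_def of_nat_mult of_nat_power
    by (intro mult_left_mono mult_right_mono) (auto simp: of_nat_div_le_of_nat)
  also have "\<dots> = 2 * real d * n / L" using L by (simp add: m_def field_simps)
  finally have q: "real q \<le> 2 * real d * n / L" .
  have "{E \<in> regular_graphs n d. sep_dim {0..<n} E \<le> k} \<subseteq>
      {E \<in> bounded_degree_graphs {0..<n} d. sep_dim {0..<n} E \<le> k}"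
    by (auto simp: regular_graphs_def bounded_degree_graphs_def)
  moreover have "finite {E \<in> bounded_degree_graphs {0..<n} d. sep_dim {0..<n} E \<le> k}"
    by (rule finite_subset[of _ "Pow (Pow {0..<n})"]) (auto simp: bounded_degree_graphs_def)
  ultimately have "card {E \<in> regular_graphs n d. sep_dim {0..<n} E \<le> k} \<le>
    card {E \<in> bounded_degree_graphs {0..<n} d. sep_dim {0..<n} E \<le> k}"
    by (rule card_mono[rotated])
  also have "\<dots> \<le> (fact n + 1) ^ k * ((L ^ k * m + 1) ^ (d * n) * (n\<^sup>2 + 1) ^ q)"
    using card_sep_dim_le[of "{0..<n}" L m d k] nL L(3) \<open>m > 0\<close> by (simp add: q_def)
  finally have "real (card {E \<in> regular_graphs n d. sep_dim {0..<n} E \<le> k}) \<le>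
      real ((fact n + 1) ^ k * ((L ^ k * m + 1) ^ (d * n) * (n\<^sup>2 + 1) ^ q))"
    by (simp only: of_nat_le_iff)
  also have "\<dots> = (fact n + 1) ^ k * ((real L ^ k * m + 1) ^ (d * n) * ((real n)\<^sup>2 + 1) ^ q)"
    by (simp only: of_nat_mult of_nat_power of_nat_add of_nat_1 of_nat_fact)
  also have "\<dots> \<le> exp (real k * n * ln n) *
      (exp (real d * n * (ln 2 + (2 * real k + 1) * ln (log 2 n + 1))) * exp (6 * real d * n))"
  proof (intro mult_mono)
    have "fact n + 1 \<le> n ^ n" using assms
    proof (induction n rule: dec_induct)
      case (step n)
      have "fact (Suc n) + 1 \<le> Suc n * (fact n + 1)" by simp
      also have "\<dots> \<le> Suc n * n ^ n" using step.IH by (intro mult_left_mono) auto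
      also have "\<dots> \<le> Suc n * Suc n ^ n" by (intro mult_left_mono power_mono) auto
      finally show ?case by (simp only: power_Suc)
    qed (simp add: fact_2)
    then have "real (fact n + 1) \<le> real (n ^ n)" by (simp only: of_nat_le_iff)
    then have "(fact n + 1 :: real) \<le> real n ^ n"
      by (simp only: of_nat_add of_nat_fact of_nat_1 of_nat_power)
    then have "(fact n + 1 :: real) ^ k \<le> (real n ^ n) ^ k" by (rule power_mono) simp
    also have "\<dots> = real n ^ (k * n)" by (metis power_mult mult.commute)
    also have "\<dots> = exp (real k * n * ln n)"
      using assms exp_of_nat_mult[of "k * n" "ln (real n)"] by simp
    finally show "(fact n + 1 :: real) ^ k \<le> exp (real k * n * ln n)" .

    have pos: "log 2 n + 1 > 0" using log1 by linarith
    have pw: "exp ((2 * real k + 1) * ln y) = y ^ (2 * k + 1)" if "y > 0" for y :: real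
      using exp_of_nat_mult[of "2 * k + 1" "ln y"] that by (simp add: add.commute)
    have "real L ^ k * m = real L ^ (k + (k + 1))"
      by (simp only: m_def power_add of_nat_mult of_nat_power)
    then have "real L ^ k * m = real L ^ (2 * k + 1)"
      by (simp add: mult_2)
    moreover have "real L ^ (2 * k + 1) \<ge> 1" using L(3) by (intro one_le_power) simp
    ultimately have "real L ^ k * m + 1 \<le> 2 * real L ^ (2 * k + 1)" by linarith
    also have "\<dots> \<le> 2 * (log 2 n + 1) ^ (2 * k + 1)"
      by (intro mult_left_mono power_mono L(2)) simp_all
    also have "\<dots> = exp (ln 2 + (2 * real k + 1) * ln (log 2 n + 1))"
      by (simp only: exp_add pw[OF pos] exp_ln zero_less_numeral)
    finally have "(real L ^ k * m + 1) ^ (d * n) \<le>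
        exp (ln 2 + (2 * real k + 1) * ln (log 2 n + 1)) ^ (d * n)"
      by (rule power_mono) (intro add_nonneg_nonneg mult_nonneg_nonneg zero_le_power of_nat_0_le_iff zero_le_one)
    also have "\<dots> = exp (real d * n * (ln 2 + (2 * real k + 1) * ln (log 2 n + 1)))"
      by (simp only: exp_of_nat_mult[symmetric] of_nat_mult)
    finally show "(real L ^ k * m + 1) ^ (d * n) \<le>
      exp (real d * n * (ln 2 + (2 * real k + 1) * ln (log 2 n + 1)))" .

    have "ln n = log 2 n * ln 2" using assms by (simp add: log_def)
    also have "\<dots> \<le> log 2 n * 1" using log1 ln_2_less_1 by (intro mult_left_mono) auto
    \<comment> \<open>Each far edge costs a factor of at most \<open>exp (3 * ln n)\<close>; by this
      bound \<open>ln n\<close> cancels against the denominator \<open>L\<close> in the bound on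
      \<open>q\<close>.\<close>
    finally have lnL: "ln n \<le> L" using L(1) by linarith
    have "(real n)\<^sup>2 \<ge> 1" using assms by (intro one_le_power) auto
    then have "(real n)\<^sup>2 + 1 \<le> 2 * (real n)\<^sup>2" by linarith
    also have "\<dots> \<le> real n * (real n)\<^sup>2" using assms by (intro mult_right_mono) simp_all
    also have "\<dots> = exp (3 * ln n)"
      using assms exp_of_nat_mult[of 3 "ln (real n)"] by (simp add: power3_eq_cube power2_eq_square)
    finally have "((real n)\<^sup>2 + 1) ^ q \<le> exp (3 * ln n) ^ q" by (rule power_mono) simp
    also have "\<dots> = exp (q * (3 * ln n))" by (rule exp_of_nat_mult[symmetric])
    also have "\<dots> \<le> exp (6 * real d * n)"
    proof -
      have "q * (3 * ln n) \<le> (2 * real d * n / L) * (3 * L)"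
        using q lnL assms by (intro mult_mono) simp_all
      also have "\<dots> = 6 * real d * n" using L(3) by simp
      finally show ?thesis by simp
    qed
    finally show "((real n)\<^sup>2 + 1) ^ q \<le> exp (6 * real d * n)" .
  qed auto
  also have "\<dots> = exp (real k * n * ln n + real d * n * (ln 2 + (2 * real k + 1) * ln (log 2 n + 1)) + 6 * real d * n)"
    by (simp add: exp_add)
  finally show ?thesis .
qed

text \<open>The leading part is \<open>(k - d / 2) * n * ln n\<close>, with coefficient at most
  -1/2. All other terms are of smaller order, the largest being \<open>n\<close> times an iterated
  logarithm.\<close>

lemma small_sep_dim_exponent_at_bot:
  fixes C a d k :: real
  assumes "d > 0" "2 * k + 1 \<le> d"
  shows "filterlim (\<lambda>n :: nat. k * n * ln n + d * n * (ln 2 + a * ln (log 2 n + 1)) + 6 * d * n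
     - d / 2 * (real n - C) * (ln ((real n - C) / (2 * d)) - 1)) at_bot at_top"
proof -
  \<comment> \<open>The exponent without its \<open>k\<close> term, divided by
    \<open>n * ln n\<close> and increased by \<open>d / 2\<close>. What remains tends to 0.\<close>
  define r where "r n = d * ((ln 2 + a * ln (log 2 n + 1)) / ln n) + 6 * d / ln n +
     d / 2 * (1 - (n - C) * ln (n - C) / (n * ln n)) +
     d / 2 * (1 + ln (2 * d)) * ((n - C) / (n * ln n))" for n :: real
  have "(r \<longlongrightarrow> d * 0 + 0 + d / 2 * 0 + d / 2 * (1 + ln (2 * d)) * 0) at_top"
    unfolding r_def by (intro tendsto_intros) real_asymp+
  then have "((\<lambda>n::nat. r n) \<longlongrightarrow> 0) at_top"
    by (simp add: filterlim_compose[OF _ filterlim_real_sequentially])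
  \<comment> \<open>Half of the gap 1/2 between \<open>k\<close> and \<open>d / 2\<close> is given
    to the error; the other half keeps the total coefficient at most -1/4.\<close>
  then have r: "\<forall>\<^sub>F n :: nat in at_top. r n < 1 / 4"
    by (rule order_tendstoD) simp
  have "filterlim (\<lambda>n::nat. - (1 / 4) * (n * ln n)) at_bot at_top" by real_asymp
  then show ?thesis
  proof (rule filterlim_at_bot_mono)
    show "\<forall>\<^sub>F n :: nat in at_top. k * n * ln n + d * n * (ln 2 + a * ln (log 2 n + 1)) + 6 * d * n
     - d / 2 * (real n - C) * (ln ((real n - C) / (2 * d)) - 1) \<le> - (1 / 4) * (n * ln n)"
      using r eventually_ge_at_top[of 2] eventually_gt_at_top[of "nat \<lceil>C\<rceil>"]
    proof eventually_elim
      case (elim n)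
      have n: "real n * ln n > 0" "ln n > 0" "real n > 0" using elim by auto
      have nC: "real n - C > 0" using elim by linarith
      have ln: "ln ((real n - C) / (2 * d)) = ln (real n - C) - ln (2 * d)"
        using assms nC by (simp add: ln_div)
      have alg: "(d * (A / l) + 6 * d / l + d / 2 * (1 - M * lM / (N * l)) +
          d / 2 * (1 + c) * (M / (N * l))) * (N * l) =
        d * N * A + 6 * d * N + d / 2 * (N * l - M * lM) + d / 2 * (1 + c) * M"
        if "l > 0" "N > 0" for A l M lM N c :: real
        using that by (simp add: field_simps)
      have rX: "r n * (n * ln n) = d * n * (ln 2 + a * ln (log 2 n + 1)) + 6 * d * n +
          d / 2 * (n * ln n - (n - C) * ln (n - C)) + d / 2 * (1 + ln (2 * d)) * (n - C)"
        unfolding r_def by (rule alg[OF n(2,3)])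
      have "d * n * (ln 2 + a * ln (log 2 n + 1)) + 6 * d * n
         - d / 2 * (real n - C) * (ln ((real n - C) / (2 * d)) - 1) =
         (r n - d / 2) * (n * ln n)"
        unfolding ln left_diff_distrib[of "r n"] rX by (simp add: algebra_simps add_divide_distrib diff_divide_distrib)
      also have "\<dots> \<le> (1 / 4 - d / 2) * (n * ln n)"
        using n elim by (intro mult_right_mono) auto
      finally have "k * n * ln n + d * n * (ln 2 + a * ln (log 2 n + 1)) + 6 * d * n
         - d / 2 * (real n - C) * (ln ((real n - C) / (2 * d)) - 1) \<le>
         (k + 1 / 4 - d / 2) * (n * ln n)" by (simp add: algebra_simps add_divide_distrib diff_divide_distrib)
      also have "\<dots> \<le> - (1 / 4) * (n * ln n)"
        using n assms by (intro mult_right_mono) auto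
      finally show ?case .
    qed
  qed
qed

theorem theorem2:
  fixes d :: nat
  assumes "d > 0"
  shows "((\<lambda>n. prob_sep_ge n d (nat \<lceil>real d / 2\<rceil>)) \<longlongrightarrow> 1)
           (inf at_top (principal {n. regular_graphs n d \<noteq> {}}))"
proof -
  define K where "K = nat \<lceil>real d / 2\<rceil>"
  \<comment> \<open>Failure means dimension at most \<open>K - 1\<close>. Rounding up gives
    \<open>2 * K \<le> d + 1\<close>, so \<open>2 * k + 1 \<le> d\<close>: the exponent
    \<open>k\<close> from the choice of permutations stays strictly below the \<open>d / 2\<close>
    from the number of regular graphs.\<close>
  define k where "k = K - 1"
  have "K \<ge> 1" "2 * K \<le> d + 1" unfolding K_def using assms by linarith+
  then have k: "2 * k + 1 \<le> d" "\<And>x. x < K \<longleftrightarrow> x \<le> k" unfolding k_def by linarith+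
  obtain C where C: "C \<ge> 0" "\<And>n. regular_graphs n d \<noteq> {} \<Longrightarrow> real n \<ge> C + 2 * real d * exp 1 \<Longrightarrow>
    exp (real d / 2 * (real n - C) * (ln ((real n - C) / (2 * real d)) - 1)) \<le> card (regular_graphs n d)"
    using card_regular_graphs_growth[OF assms] by blast
  define g where "g n = real k * n * ln n + real d * n * (ln 2 + (2 * real k + 1) * ln (log 2 n + 1)) + 6 * real d * n
     - real d / 2 * (real n - C) * (ln ((real n - C) / (2 * real d)) - 1)" for n :: nat
  let ?F = "inf at_top (principal {n. regular_graphs n d \<noteq> {}})"
  have "filterlim g at_bot at_top"
    unfolding g_def using k(1) assms by (intro small_sep_dim_exponent_at_bot) auto
  then have "((\<lambda>n. exp (g n)) \<longlongrightarrow> 0) at_top"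
    by (rule filterlim_compose[OF exp_at_bot])
  then have exp_g: "((\<lambda>n. exp (g n)) \<longlongrightarrow> 0) ?F"
    by (rule tendsto_mono[rotated]) simp
  have "\<forall>\<^sub>F n in ?F. norm (prob_sep_ge n d K - 1) \<le> exp (g n)"
    unfolding eventually_inf_principal
    using eventually_ge_at_top[of 2] eventually_ge_at_top[of "nat \<lceil>C + 2 * real d * exp 1\<rceil>"]
  proof eventually_elim
    case (elim n)
    show ?case
    proof
      assume "n \<in> {n. regular_graphs n d \<noteq> {}}"
      then have ne: "regular_graphs n d \<noteq> {}" by simp
      let ?R = "regular_graphs n d"
      let ?good = "{E \<in> ?R. sep_dim {0..<n} E \<ge> K}" and ?bad = "{E \<in> ?R. sep_dim {0..<n} E \<le> k}"
      have nC: "C + 2 * real d * exp 1 \<le> real n" using elim by linarith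
      have R: "card ?R > 0" using ne finite_regular_graphs[of n d] by (simp add: card_gt_0_iff)
      have "?R = ?good \<union> ?bad" "?good \<inter> ?bad = {}" using k(2) by (auto simp: not_less[symmetric])
      then have "card ?R = card ?good + card ?bad"
        using card_Un_disjoint[of ?good ?bad] finite_regular_graphs[of n d] by simp
      then have split: "real (card ?good) = real (card ?R) - real (card ?bad)" by simp
      \<comment> \<open>The deviation from 1 is the proportion of bad graphs, so the upper bound on
        bad graphs and the lower bound on all regular graphs combine to
        \<open>exp (g n)\<close>.\<close>
      have "prob_sep_ge n d K - 1 = - (card ?bad / card ?R)"
        unfolding prob_sep_ge_def split diff_divide_distrib using R by simp
      then have "norm (prob_sep_ge n d K - 1) = card ?bad / card ?R" by simp
      also have "\<dots> \<le> exp (real k * n * ln n + real d * n * (ln 2 + (2 * real k + 1) * ln (log 2 n + 1)) + 6 * real d * n) /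
          exp (real d / 2 * (real n - C) * (ln ((real n - C) / (2 * real d)) - 1))"
        by (intro frac_le card_small_sep_dim_regular_graphs C(2) exp_ge_zero exp_gt_zero elim(1) ne nC)
      also have "\<dots> = exp (g n)" by (simp add: g_def exp_diff)
      finally show "norm (prob_sep_ge n d K - 1) \<le> exp (g n)" .
    qed
  qed
  then have "((\<lambda>n. prob_sep_ge n d K - 1) \<longlongrightarrow> 0) ?F"
    by (intro tendsto_0_le[OF exp_g, of _ 1]) simp
  then show ?thesis unfolding K_def by (rule LIM_zero_cancel)
qed

end
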